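(* Let $n\geq 1$, $q\geq 2$ and $s\geq 0$ be integers. For each $1\leq i\leq n$ let $A_i\subseteq \mathbb{R}$ be a subset with $|A_i|=q$, and consider the box $\mathcal{B}:=\prod_{i=1}^n A_i\subseteq \mathbb{R}^n$. Suppose that $\mathcal{F}\subseteq \mathcal{B}$ is a set satisfying the following properties: (i) $(\mathbf{f},\mathbf{f})\notin s(\mathcal{F})$ for each $\mathbf{f}\in \mathcal{F}$; (ii) $|s(\mathcal{F})|\leq s$. Then $$ |\mathcal{F}|\leq \Big|\Big\{x_1^{\alpha_1}\cdots x_n^{\alpha_n}:~ 0\leq \alpha_i \leq q-1 \text{ for each } 1\le i\le n,\ \sum_{i=1}^n \alpha_i \leq s \Big\}\Big|, $$ where the set on the right is a set of monomials in the variables $x_1,\dots,x_n$ with integer exponents $\alpha_i$.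
   Context: $(\mathbf{x},\mathbf{y})$ denotes the standard scalar product on $\mathbb{R}^n$. For a set $\mathcal{G}\subseteq\mathbb{R}^n$, $s(\mathcal{G})$ denotes the set of scalar products between distinct points of $\mathcal{G}$: $s(\mathcal{G}):=\{(\mathbf{p}_1,\mathbf{p}_2): \mathbf{p}_1,\mathbf{p}_2\in\mathcal{G},\ \mathbf{p}_1\neq\mathbf{p}_2\}$. (The integer $s$ in the claim is a number, distinct from the set-valued notation $s(\cdot)$.) *)

theory Defs
  imports "HOL-Analysis.Analysis" "HOL-Library.Poly_Mapping"
begin

definition scalar_products :: "(real ^ 'n::finite) set \<Rightarrow> real set" where
  "scalar_products G = {p1 \<bullet> p2 | p1 p2. p1 \<in> G \<and> p2 \<in> G \<and> p1 \<noteq> p2}"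

definition box_of :: "('n::finite \<Rightarrow> real set) \<Rightarrow> (real ^ 'n) set" where
  "box_of A = {x. \<forall>i. x $ i \<in> A i}"

text \<open>Polynomials in the variables \<open>x\<^sub>i\<close>, with \<open>i\<close> ranging over the type \<open>'n\<close>, are represented as
  finitely supported maps from exponent vectors to coefficients, with the convolution product of
  \<^theory>\<open>HOL-Library.Poly_Mapping\<close>.\<close>

type_synonym 'n mpolynomial = "('n \<Rightarrow>\<^sub>0 nat) \<Rightarrow>\<^sub>0 real"

definition var :: "'n \<Rightarrow> 'n mpolynomial" where
  "var i = Poly_Mapping.single (Poly_Mapping.single i 1) 1"

definition monomial_of :: "('n::finite \<Rightarrow> nat) \<Rightarrow> 'n mpolynomial" where
  "monomial_of \<alpha> = (\<Prod>i\<in>UNIV. var i ^ \<alpha> i)"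

end

theory Submission imports Defs "HOL-Library.Function_Algebras"
begin

text \<open>Attach to each \<open>f \<in> F\<close> the polynomial \<open>P\<^sub>f(x) = \<Prod>\<^sub>t ((f, x) - t)\<close>, with \<open>t\<close> ranging over
  \<open>s(F)\<close>. By (i), \<open>P\<^sub>f\<close> does not vanish at \<open>f\<close>, but it vanishes at every other point of \<open>F\<close>, so the
  functions \<open>P\<^sub>f\<close> on the box are linearly independent. They have degree at most \<open>s\<close>. On
  \<open>A\<^sub>i\<close>, the power \<open>x\<^sub>i\<^sup>q\<close> agrees with a polynomial in \<open>x\<^sub>i\<close> of smaller degree, so on the box every
  polynomial of degree at most \<open>s\<close> is a combination of the monomials on the right-hand side.\<close>

interpretation fun_vs: vector_space "\<lambda>(c::real) (f::'a \<Rightarrow> real) x. c * f x"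
  by unfold_locales (auto simp: fun_eq_iff algebra_simps)

lemma sum_fun_apply: "sum G S x = (\<Sum>i\<in>S. G i x)" for G :: "'b \<Rightarrow> 'a \<Rightarrow> 'c::comm_monoid_add"
  by (induction S rule: infinite_finite_induct) auto

text \<open>Evaluation at \<open>f\<close> is linear and kills every \<open>P g\<close> with
  \<open>g\<close> in \<open>F\<close> other than \<open>f\<close>, hence their whole span; since it
  does not kill \<open>P f\<close>, no member of the family depends on the others.\<close>

lemma fun_vs_independent_family:
  fixes P :: "'a \<Rightarrow> 'a \<Rightarrow> real"
  assumes diag: "\<And>f. f \<in> F \<Longrightarrow> P f f \<noteq> 0"
    and off: "\<And>f g. f \<in> F \<Longrightarrow> g \<in> F \<Longrightarrow> f \<noteq> g \<Longrightarrow> P f g = 0"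
  shows "inj_on P F" and "fun_vs.independent (P ` F)"
proof -
  show "inj_on P F"
    by (rule inj_onI) (metis diag off)
  show "fun_vs.independent (P ` F)"
    unfolding fun_vs.dependent_def
  proof
    assume "\<exists>a\<in>P ` F. a \<in> fun_vs.span (P ` F - {a})"
    then obtain f where f: "f \<in> F" "P f \<in> fun_vs.span (P ` F - {P f})" by auto
    from f(2) have "P f f = 0"
    proof (induction rule: fun_vs.span_induct_alt)
      case base
      then show ?case by simp
    next
      case (step c x y)
      then obtain g where "g \<in> F" "x = P g" "g \<noteq> f" by auto
      then show ?case using step off[of g f] f(1) by simp
    qed
    with diag f(1) show False by simp
  qed
qed

text \<open>The monic polynomial with root set \<open>A\<close> has degree \<open>card A\<close> and
  vanishes on \<open>A\<close>; solving for its leading term gives the coefficients.\<close>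

lemma power_card_reduce:
  fixes A :: "real set"
  assumes "finite A"
  obtains c where "\<And>x. x \<in> A \<Longrightarrow> x ^ card A = (\<Sum>k<card A. c k * x ^ k)"
proof -
  define p where "p = (\<Prod>a\<in>A. [:- a, 1:])"
  have deg: "degree p = card A"
    unfolding p_def by (subst degree_prod_eq_sum_degree) auto
  have lc: "lead_coeff p = 1"
    unfolding p_def by (subst lead_coeff_prod) simp
  have "x ^ card A = (\<Sum>k<card A. - coeff p k * x ^ k)" if "x \<in> A" for x
  proof -
    have "0 = poly p x"
      using that assms by (auto simp: p_def poly_prod intro!: prod_zero bexI[of _ x])
    also have "\<dots> = (\<Sum>k<card A. coeff p k * x ^ k) + x ^ card A"
      using lc deg by (simp add: poly_altdef lessThan_Suc_atMost[symmetric])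
    finally show ?thesis by (simp add: sum_negf)
  qed
  then show ?thesis by (rule that)
qed

text \<open>The value 0 off \<open>B\<close> turns identities that hold only on \<open>B\<close>
  into equalities of total functions, so restriction to \<open>B\<close> requires no quotient or
  subtype.\<close>

definition monomial_on :: "(real ^ 'n::finite) set \<Rightarrow> ('n \<Rightarrow> nat) \<Rightarrow> real ^ 'n \<Rightarrow> real" where
  "monomial_on B \<alpha> x = (if x \<in> B then \<Prod>i\<in>UNIV. x $ i ^ \<alpha> i else 0)"

lemma prod_power_fun_upd:
  fixes z :: "'n::finite \<Rightarrow> real"
  shows "(\<Prod>j\<in>UNIV. z j ^ (\<alpha>(i := k)) j) = z i ^ k * (\<Prod>j\<in>UNIV - {i}. z j ^ \<alpha> j)"
  by (subst prod.remove[of _ i]) auto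

lemma sum_fun_upd_nat:
  fixes \<alpha> :: "'n::finite \<Rightarrow> nat"
  shows "(\<Sum>j\<in>UNIV. (\<alpha>(i := k)) j) = k + (\<Sum>j\<in>UNIV - {i}. \<alpha> j)"
  by (subst sum.remove[of _ i]) auto

text \<open>Multiplication by a coordinate raises one exponent by 1, and multiplication by
  \<open>t\<close> leaves the degree alone; the rest is linearity.\<close>

lemma monomial_on_times_linear:
  assumes "g \<in> fun_vs.span (monomial_on B ` {\<alpha>. (\<Sum>i\<in>UNIV. \<alpha> i) \<le> d})"
  shows "(\<lambda>x. (f \<bullet> x - t) * g x) \<in> fun_vs.span (monomial_on B ` {\<alpha>. (\<Sum>i\<in>UNIV. \<alpha> i) \<le> Suc d})"
    (is "_ \<in> ?V")
  using assms
proof (induction rule: fun_vs.span_induct_alt)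
  case base
  have "(\<lambda>x. (f \<bullet> x - t) * (0 :: real ^ 'a \<Rightarrow> real) x) = 0" by (simp add: fun_eq_iff)
  then show ?case using fun_vs.span_zero by metis
next
  case (step c h y)
  then obtain \<alpha> where \<alpha>: "(\<Sum>i\<in>UNIV. \<alpha> i) \<le> d" "h = monomial_on B \<alpha>" by auto
  \<comment> \<open>The second instance below is the trivial update, which isolates the factor of
    \<open>\<alpha>\<close> at \<open>i\<close> for comparison.\<close>
  have shift: "monomial_on B (\<alpha>(i := Suc (\<alpha> i))) x = x $ i * monomial_on B \<alpha> x" for i x
    using prod_power_fun_upd[of "\<lambda>j. x $ j" \<alpha> i "Suc (\<alpha> i)"]
      prod_power_fun_upd[of "\<lambda>j. x $ j" \<alpha> i "\<alpha> i"]
    by (simp add: monomial_on_def del: fun_upd_apply)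
  have "monomial_on B (\<alpha>(i := Suc (\<alpha> i))) \<in> ?V" for i
    using \<alpha>(1) sum_fun_upd_nat[of \<alpha> i "Suc (\<alpha> i)"] sum_fun_upd_nat[of \<alpha> i "\<alpha> i"]
    by (intro fun_vs.span_base imageI) (simp del: fun_upd_apply)
  then have "(\<Sum>i\<in>UNIV. (\<lambda>x. (c * f $ i) * monomial_on B (\<alpha>(i := Suc (\<alpha> i))) x)) \<in> ?V"
    by (intro fun_vs.span_sum fun_vs.span_scale)
  moreover have "h \<in> ?V"
    using \<alpha> by (intro fun_vs.span_base) auto
  then have "(\<lambda>x. (c * t) * h x) \<in> ?V" by (rule fun_vs.span_scale)
  moreover note step.IH
  ultimately have "(\<Sum>i\<in>UNIV. (\<lambda>x. (c * f $ i) * monomial_on B (\<alpha>(i := Suc (\<alpha> i))) x))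
      - (\<lambda>x. (c * t) * h x) + (\<lambda>x. (f \<bullet> x - t) * y x) \<in> ?V" (is "?w \<in> _")
    by (intro fun_vs.span_add fun_vs.span_diff)
  moreover have "?w = (\<lambda>x. (f \<bullet> x - t) * ((\<lambda>x. c * h x) + y) x)"
  proof
    fix x
    have "(\<Sum>i\<in>UNIV. (c * f $ i) * monomial_on B (\<alpha>(i := Suc (\<alpha> i))) x) = c * (f \<bullet> x) * h x"
      unfolding shift \<alpha>(2) inner_vec_def by (simp add: sum_distrib_left sum_distrib_right mult_ac)
    then have "?w x = c * (f \<bullet> x) * h x - c * t * h x + (f \<bullet> x - t) * y x"
      by (simp only: plus_fun_apply fun_diff_def sum_fun_apply)
    then show "?w x = (f \<bullet> x - t) * ((\<lambda>x. c * h x) + y) x"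
      unfolding plus_fun_apply by algebra
  qed
  ultimately show ?case by simp
qed

lemma prod_linear_in_span:
  fixes f :: "real ^ 'n::finite"
  assumes "finite T"
  shows "(\<lambda>x. if x \<in> B then \<Prod>t\<in>T. f \<bullet> x - t else 0)
    \<in> fun_vs.span (monomial_on B ` {\<alpha>. (\<Sum>i\<in>UNIV. \<alpha> i) \<le> card T})"
  using assms
proof (induction T)
  case empty
  have "(\<lambda>x. if x \<in> B then \<Prod>t\<in>{}. f \<bullet> x - t else 0) = monomial_on B (\<lambda>_. 0)"
    by (simp add: fun_eq_iff monomial_on_def)
  then show ?case by (auto intro!: fun_vs.span_base)
next
  case (insert t T)
  have "(\<lambda>x. if x \<in> B then \<Prod>t\<in>insert t T. f \<bullet> x - t else 0)
      = (\<lambda>x. (f \<bullet> x - t) * (if x \<in> B then \<Prod>t\<in>T. f \<bullet> x - t else 0))"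
    using insert.hyps by (auto simp: fun_eq_iff)
  then show ?case
    using monomial_on_times_linear[OF insert.IH, of f t] insert.hyps by simp
qed

text \<open>If some exponent is at least \<open>q\<close>, replacing a factor
  \<open>x $ i ^ q\<close> by lower powers of \<open>x $ i\<close> is valid on the box and strictly
  lowers the total degree. Induction on that degree ends with all exponents below \<open>q\<close>,
  and the bound \<open>d\<close> is never exceeded.\<close>

lemma monomial_on_box_in_span:
  fixes A :: "'n::finite \<Rightarrow> real set"
  assumes fin: "\<And>i. finite (A i)" and card: "\<And>i. card (A i) = q"
    and "(\<Sum>i\<in>UNIV. \<alpha> i) \<le> d"
  shows "monomial_on (box_of A) \<alpha>
    \<in> fun_vs.span (monomial_on (box_of A) ` {\<alpha>. (\<forall>i. \<alpha> i < q) \<and> (\<Sum>i\<in>UNIV. \<alpha> i) \<le> d})"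
    (is "_ \<in> ?V")
  using assms(3)
proof (induction "\<Sum>i\<in>UNIV. \<alpha> i" arbitrary: \<alpha> rule: less_induct)
  case less
  show ?case
  proof (cases "\<forall>i. \<alpha> i < q")
    case True
    with less.prems show ?thesis by (intro fun_vs.span_base) auto
  next
    case False
    then obtain i where i: "q \<le> \<alpha> i" by (auto simp: not_less)
    obtain c where c: "\<And>x. x \<in> A i \<Longrightarrow> x ^ q = (\<Sum>k<q. c k * x ^ k)"
      using power_card_reduce[OF fin[of i]] card[of i] by metis
    \<comment> \<open>The exponent vector after trading \<open>x $ i ^ q\<close> for
      \<open>x $ i ^ k\<close>; the subtraction is not truncated because
      \<open>q \<le> \<alpha> i\<close>.\<close>
    define \<beta> where "\<beta> k = \<alpha>(i := \<alpha> i - q + k)" for k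
    have sum_\<beta>: "(\<Sum>j\<in>UNIV. \<beta> k j) < (\<Sum>j\<in>UNIV. \<alpha> j)" if "k < q" for k
      using sum_fun_upd_nat[of \<alpha> i "\<alpha> i - q + k"] sum_fun_upd_nat[of \<alpha> i "\<alpha> i"] i that
      by (simp add: \<beta>_def del: fun_upd_apply)
    have "monomial_on (box_of A) (\<beta> k) \<in> ?V" if "k < q" for k
      using sum_\<beta>[OF that] less.prems by (intro less.hyps) auto
    then have "(\<Sum>k<q. (\<lambda>x. c k * monomial_on (box_of A) (\<beta> k) x)) \<in> ?V"
      by (intro fun_vs.span_sum fun_vs.span_scale) simp
    moreover have "monomial_on (box_of A) \<alpha> = (\<Sum>k<q. (\<lambda>x. c k * monomial_on (box_of A) (\<beta> k) x))"
    proof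
      fix x
      show "monomial_on (box_of A) \<alpha> x = (\<Sum>k<q. (\<lambda>x. c k * monomial_on (box_of A) (\<beta> k) x)) x"
      proof (cases "x \<in> box_of A")
        case True
        define R where "R = (\<Prod>j\<in>UNIV - {i}. x $ j ^ \<alpha> j)"
        have "monomial_on (box_of A) \<alpha> x = x $ i ^ \<alpha> i * R"
          using True prod_power_fun_upd[of "\<lambda>j. x $ j" \<alpha> i "\<alpha> i"]
          by (simp add: monomial_on_def R_def)
        also have "x $ i ^ \<alpha> i = x $ i ^ (\<alpha> i - q) * x $ i ^ q"
          using i by (simp add: power_add[symmetric])
        also have "x $ i ^ q = (\<Sum>k<q. c k * x $ i ^ k)"
          using True by (intro c) (simp add: box_of_def)
        also have "x $ i ^ (\<alpha> i - q) * (\<Sum>k<q. c k * x $ i ^ k) * R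
            = (\<Sum>k<q. c k * (x $ i ^ (\<alpha> i - q + k) * R))"
          by (simp add: sum_distrib_left sum_distrib_right power_add mult_ac)
        also have "\<dots> = (\<Sum>k<q. c k * monomial_on (box_of A) (\<beta> k) x)"
          using True prod_power_fun_upd[of "\<lambda>j. x $ j" \<alpha> i]
          by (simp add: monomial_on_def R_def \<beta>_def del: fun_upd_apply)
        finally show ?thesis by (simp add: sum_fun_apply)
      qed (simp add: sum_fun_apply monomial_on_def)
    qed
    ultimately show ?thesis by simp
  qed
qed

lemma monomial_of_eq_single:
  "monomial_of \<alpha> = Poly_Mapping.single (\<Sum>i\<in>UNIV. Poly_Mapping.single i (\<alpha> i)) 1"
proof -
  have pow: "var i ^ k = Poly_Mapping.single (Poly_Mapping.single i k) 1" for i :: 'a and k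
    by (induction k) (simp_all add: var_def mult_single single_add[symmetric])
  have "(\<Prod>i\<in>S. var i ^ \<alpha> i) = Poly_Mapping.single (\<Sum>i\<in>S. Poly_Mapping.single i (\<alpha> i)) 1"
    if "finite S" for S
    using that by induction (simp_all add: pow mult_single)
  then show ?thesis by (simp add: monomial_of_def)
qed

text \<open>A monomial has coefficient 1 at its own exponent vector and 0 elsewhere, so it
  determines its exponents. Counting formal monomials thus amounts to counting exponent
  vectors.\<close>

lemma inj_monomial_of: "inj monomial_of"
proof (rule injI)
  fix \<alpha> \<beta> :: "'a \<Rightarrow> nat"
  assume "monomial_of \<alpha> = monomial_of \<beta>"
  then have "Poly_Mapping.lookup (monomial_of \<alpha>) (\<Sum>i\<in>UNIV. Poly_Mapping.single i (\<beta> i)) = 1"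
    by (simp add: monomial_of_eq_single)
  then have eq: "(\<Sum>i\<in>UNIV. Poly_Mapping.single i (\<alpha> i)) = (\<Sum>i\<in>UNIV. Poly_Mapping.single i (\<beta> i))"
    by (simp add: monomial_of_eq_single lookup_single when_def split: if_splits)
  have "Poly_Mapping.lookup (\<Sum>i\<in>UNIV. Poly_Mapping.single i (\<gamma> i)) j = \<gamma> j" for \<gamma> :: "'a \<Rightarrow> nat" and j
    by (simp add: lookup_sum lookup_single when_def)
  with eq show "\<alpha> = \<beta>" by (metis ext)
qed

theorem theorem1p7:
  fixes A :: "'n::finite \<Rightarrow> real set" and F :: "(real ^ 'n) set" and q s :: nat
  assumes "q \<ge> 2"
    and "\<And>i. card (A i) = q"
    and "F \<subseteq> box_of A"
    and "\<And>f. f \<in> F \<Longrightarrow> f \<bullet> f \<notin> scalar_products F"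
    and "card (scalar_products F) \<le> s"
  shows "card F \<le> card {monomial_of \<alpha> | \<alpha> :: 'n \<Rightarrow> nat.
      (\<forall>i. \<alpha> i \<le> q - 1) \<and> (\<Sum>i\<in>UNIV. \<alpha> i) \<le> s}"
proof -
  define E where "E = {\<alpha> :: 'n \<Rightarrow> nat. (\<forall>i. \<alpha> i < q) \<and> (\<Sum>i\<in>UNIV. \<alpha> i) \<le> s}"
  have "E \<subseteq> UNIV \<rightarrow>\<^sub>E {..<q}" by (auto simp: E_def)
  then have finE: "finite E" by (rule finite_subset) (simp add: finite_PiE)
  \<comment> \<open>An infinite set has \<open>card\<close> 0, which \<open>q \<ge> 2\<close>
    excludes.\<close>
  have finA: "finite (A i)" for i
    using assms(1,2) by (intro card_ge_0_finite) auto
  have "box_of A \<subseteq> vec_lambda ` (\<Pi>\<^sub>E i\<in>UNIV. A i)"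
  proof
    fix x assume "x \<in> box_of A"
    then have "vec_nth x \<in> (\<Pi>\<^sub>E i\<in>UNIV. A i)" by (auto simp: box_of_def)
    then show "x \<in> vec_lambda ` (\<Pi>\<^sub>E i\<in>UNIV. A i)" by (metis image_eqI vec_nth_inverse)
  qed
  then have "finite (box_of A)"
    by (rule finite_subset) (intro finite_imageI finite_PiE finA finite_class.finite_UNIV)
  then have finF: "finite F" using assms(3) by (rule finite_subset[rotated])
  define T where "T = scalar_products F"
  have "T \<subseteq> (\<lambda>(x, y). x \<bullet> y) ` (F \<times> F)"
    by (auto simp: T_def scalar_products_def)
  \<comment> \<open>A product over an infinite set would be 1 by convention; finiteness makes
    \<open>P\<close> vanish exactly where some factor does, for points of the box.\<close>
  then have finT: "finite T" using finF by (auto intro: finite_subset)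
  define P where "P f x = (if x \<in> box_of A then \<Prod>t\<in>T. f \<bullet> x - t else 0)" for f x :: "real ^ 'n"
  have diag: "P f f \<noteq> 0" if "f \<in> F" for f
    using that assms(3,4) finT by (auto simp: P_def T_def[symmetric])
  have off: "P f g = 0" if "f \<in> F" "g \<in> F" "f \<noteq> g" for f g
  proof -
    have "f \<bullet> g \<in> T" using that by (auto simp: T_def scalar_products_def)
    then show ?thesis using finT by (auto simp: P_def)
  qed
  \<comment> \<open>First expand into monomials of degree at most \<open>card T \<le> s\<close>,
    then reduce each of them on the box.\<close>
  have "P f \<in> fun_vs.span (monomial_on (box_of A) ` E)" for f
  proof -
    have "P f \<in> fun_vs.span (monomial_on (box_of A) ` {\<alpha>. (\<Sum>i\<in>UNIV. \<alpha> i) \<le> card T})"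
      unfolding P_def by (rule prod_linear_in_span[OF finT])
    also have "\<dots> \<subseteq> fun_vs.span (monomial_on (box_of A) ` E)"
      using monomial_on_box_in_span[of A, OF finA assms(2), where d = s] assms(5)
      by (intro fun_vs.span_minimal fun_vs.subspace_span) (auto simp: E_def T_def)
    finally show ?thesis .
  qed
  \<comment> \<open>An independent set inside the span of a finite set is no larger than that
    set.\<close>
  then have "card (P ` F) \<le> card (monomial_on (box_of A) ` E)"
    using fun_vs.independent_span_bound[OF finite_imageI[OF finE]
        fun_vs_independent_family(2)[of F P, OF diag off]] by blast
  also have "\<dots> \<le> card E" by (rule card_image_le[OF finE])
  also have "\<dots> = card (monomial_of ` E)"
    using inj_monomial_of by (metis card_image inj_on_subset subset_UNIV)
  also have "monomial_of ` E = {monomial_of \<alpha> | \<alpha> :: 'n \<Rightarrow> nat.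
      (\<forall>i. \<alpha> i \<le> q - 1) \<and> (\<Sum>i\<in>UNIV. \<alpha> i) \<le> s}"
  proof -
    have "a < q \<longleftrightarrow> a \<le> q - 1" for a using assms(1) by auto
    then show ?thesis by (auto simp: E_def)
  qed
  also have "card (P ` F) = card F"
    by (rule card_image[OF fun_vs_independent_family(1)[of F P, OF diag off]])
  finally show ?thesis .
qed

end
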